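(* Let $\alpha=[b_0;b_1,\ldots]$ and $\beta=[d_0;d_1,\ldots]$ be real irrational numbers and let $B_m$ and $D_n$ denote the denominators of their $m$th and $n$th convergents. Put $H=4^{1/3}$. For $n\in\mathbb{Z}_{\ge1}$ let $a(n)=m$ be the unique integer $m\ge0$ with $$B_m\le D_{n+1}<B_{m+1}.$$ For every $n\in\mathbb{Z}_{\ge1}$ there is $(x_n,y_n,z_n,v_n)\in\mathbb{Z}^4$ with $$q_n:=x_nB_{a(n)}+y_nB_{a(n)+1}=z_nD_n+v_nD_{n+1}\ge1,\qquad\max\{|x_n|,|y_n|,|z_n|,|v_n|\}\le H\,B_{a(n)+1}^{1/3},$$ and for every such $q_n$ $$\|q_n\alpha\|\le\frac{(2H)^{3/2}}{q_n^{1/2}},\qquad\|q_n\beta\|\le\frac{(2H)^{3/2}(b_{a(n)+1}+1)}{q_n^{1/2}}.$$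
   Context: For real $x$, $\|x\|:=\min_{k\in\mathbb{Z}}|x-k|$. For an irrational $\alpha=[b_0;b_1,b_2,\ldots]$ (simple continued fraction, $b_0\in\mathbb{Z}$, $b_n\in\mathbb{Z}_{\ge1}$ for $n\ge1$), the denominators of the convergents are given by $B_0=1$, $B_1=b_1$, $B_{n+2}=b_{n+2}B_{n+1}+B_n$; $D_n$ is defined likewise from the partial quotients of $\beta$. *)

theory Defs
  imports Complex_Main
begin

text \<open>The minimum \<open>min\<^sub>k \<bar>x - k\<bar>\<close> over all integers \<open>k\<close>; it is attained
  (lemma \<open>dist_int_eq_round\<close> below), so the \<open>LEAST\<close> is meaningful.\<close>

definition dist_int :: "real \<Rightarrow> real" where
  "dist_int x = (LEAST r. \<exists>k::int. r = \<bar>x - of_int k\<bar>)"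

lemma dist_int_eq_round: "dist_int x = \<bar>x - of_int (round x)\<bar>"
  unfolding dist_int_def
  by (rule Least_equality) (use round_diff_minimal in blast)+

fun cf_finite :: "(nat \<Rightarrow> int) \<Rightarrow> nat \<Rightarrow> real" where
  "cf_finite b 0 = of_int (b 0)"
| "cf_finite b (Suc n) = of_int (b 0) + 1 / cf_finite (\<lambda>k. b (Suc k)) n"

text \<open>\<open>is_simple_cf \<alpha> b\<close> renders \<open>\<alpha> = [b\<^sub>0; b\<^sub>1, b\<^sub>2, \<dots>]\<close>: the infinite simple continued
  fraction is the limit of the finite ones \<open>[b\<^sub>0; b\<^sub>1, \<dots>, b\<^sub>n]\<close>.\<close>

definition is_simple_cf :: "real \<Rightarrow> (nat \<Rightarrow> int) \<Rightarrow> bool" where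
  "is_simple_cf \<alpha> b \<longleftrightarrow> (\<forall>n\<ge>1. b n \<ge> 1) \<and> cf_finite b \<longlonglongrightarrow> \<alpha>"

fun cf_denom :: "(nat \<Rightarrow> int) \<Rightarrow> nat \<Rightarrow> int" where
  "cf_denom b 0 = 1"
| "cf_denom b (Suc 0) = b 1"
| "cf_denom b (Suc (Suc n)) = b (Suc (Suc n)) * cf_denom b (Suc n) + cf_denom b n"

definition is_denom_index :: "(nat \<Rightarrow> int) \<Rightarrow> (nat \<Rightarrow> int) \<Rightarrow> nat \<Rightarrow> nat \<Rightarrow> bool" where
  "is_denom_index b d n m \<longleftrightarrow>
     cf_denom b m \<le> cf_denom d (n + 1) \<and> cf_denom d (n + 1) < cf_denom b (m + 1)"

definition denom_index :: "(nat \<Rightarrow> int) \<Rightarrow> (nat \<Rightarrow> int) \<Rightarrow> nat \<Rightarrow> nat" where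
  "denom_index b d n = (THE m. is_denom_index b d n m)"

definition H :: real where
  "H = 4 powr (1/3)"

end

theory Submission
  imports Defs
begin

text \<open>
  The numbers \<open>q\<^sub>n\<close> come from Siegel's lemma: among the integer points of a box of side
  \<open>X = \<lfloor>(4B\<^bsub>a+1\<^esub>)\<^bsup>1/3\<^esup>\<rfloor>\<close> two must give the same value of the linear form
  \<open>xB\<^sub>a + yB\<^bsub>a+1\<^esub> - zD\<^sub>n - vD\<^bsub>n+1\<^esub>\<close>. Their difference could have common value \<open>0\<close>, but by coprimality
  of consecutive denominators only if \<open>D\<^bsub>n+1\<^esub> \<le> X\<close>; in that case one represents
  \<open>q = B\<^sub>a\<close> by \<open>D\<^sub>n, D\<^bsub>n+1\<^esub>\<close> directly. The estimates follow from
  \<open>\<parallel>B\<^sub>m\<alpha>\<parallel> \<le> 1/B\<^bsub>m+1\<^esub>\<close> and \<open>B\<^bsub>a+1\<^esub> \<le> (b\<^bsub>a+1\<^esub> + 1)B\<^sub>a \<le> (b\<^bsub>a+1\<^esub> + 1)D\<^bsub>n+1\<^esub>\<close>.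
\<close>

section \<open>Numerators and denominators of the convergents\<close>

fun cf_num :: "(nat \<Rightarrow> int) \<Rightarrow> nat \<Rightarrow> int" where
  "cf_num b 0 = b 0"
| "cf_num b (Suc 0) = b 1 * b 0 + 1"
| "cf_num b (Suc (Suc n)) = b (Suc (Suc n)) * cf_num b (Suc n) + cf_num b n"

lemma cf_denom_pos:
  assumes "\<And>n. n \<ge> 1 \<Longrightarrow> b n \<ge> 1"
  shows "cf_denom b n \<ge> 1"
proof (induction n rule: induct_nat_012)
  case (ge2 n)
  have "1 * 1 \<le> b (Suc (Suc n)) * cf_denom b (Suc n)"
    using assms[of "Suc (Suc n)"] ge2 by (intro mult_mono) auto
  then show ?case using ge2 by simp
qed (use assms in auto)

text \<open>Strict growth starts only at index 1: when \<open>b 1 = 1\<close> the denominators at 0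
  and 1 agree.\<close>

lemma cf_denom_less_Suc_Suc:
  assumes "\<And>n. n \<ge> 1 \<Longrightarrow> b n \<ge> 1"
  shows "cf_denom b (Suc n) < cf_denom b (Suc (Suc n))"
proof -
  have "1 * cf_denom b (Suc n) \<le> b (Suc (Suc n)) * cf_denom b (Suc n)"
    using assms[of "Suc (Suc n)"] cf_denom_pos[of b "Suc n", OF assms] by (intro mult_right_mono) auto
  then show ?thesis using cf_denom_pos[of b n, OF assms] by simp
qed

lemma mono_cf_denom:
  assumes "\<And>n. n \<ge> 1 \<Longrightarrow> b n \<ge> 1"
  shows "mono (cf_denom b)"
  unfolding mono_iff_le_Suc
proof
  fix n
  show "cf_denom b n \<le> cf_denom b (Suc n)"
    using cf_denom_less_Suc_Suc[of b, OF assms] assms by (cases n) (auto intro: less_imp_le)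
qed

text \<open>Supplies the unboundedness behind the existence part of
  \<open>ex1_denom_index\<close>.\<close>

lemma cf_denom_ge_index:
  assumes "\<And>n. n \<ge> 1 \<Longrightarrow> b n \<ge> 1"
  shows "cf_denom b n \<ge> int n"
proof (induction n rule: induct_nat_012)
  case (ge2 n)
  then show ?case using cf_denom_less_Suc_Suc[of b n, OF assms] by simp
qed (use assms in auto)

lemma coprime_cf_denom_Suc: "coprime (cf_denom b n) (cf_denom b (Suc n))"
proof (induction n)
  case (Suc n)
  then show ?case
    using gcd_add_mult[of "cf_denom b (Suc n)" "b (Suc (Suc n))" "cf_denom b n"]
    by (simp add: coprime_iff_gcd_eq_1 gcd.commute)
qed simp

text \<open>Bounds the previous denominator in the recurrence by the current one. This is the source
  of the factor \<open>b (a + 1) + 1\<close> in the estimate for \<beta>.\<close>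

lemma cf_denom_Suc_le:
  assumes "\<And>n. n \<ge> 1 \<Longrightarrow> b n \<ge> 1"
  shows "cf_denom b (Suc n) \<le> (b (Suc n) + 1) * cf_denom b n"
proof (cases n)
  case (Suc k)
  then show ?thesis using monoD[OF mono_cf_denom[of b, OF assms], of k "Suc k"]
    by (simp add: algebra_simps)
qed simp

text \<open>\<open>cf_finite\<close> recurses at the front of the sequence, \<open>cf_num\<close>
  and \<open>cf_denom\<close> at the back. This lemma and the next express both in terms of the
  shifted sequence, so that induction over all \<open>b\<close> can identify
  \<open>cf_finite\<close> with their quotient.\<close>

lemma cf_denom_Suc_eq_cf_num: "cf_denom b (Suc n) = cf_num (\<lambda>k. b (Suc k)) n"
  by (induction n rule: induct_nat_012) auto

lemma cf_num_Suc:
  "cf_num b (Suc n) = b 0 * cf_num (\<lambda>k. b (Suc k)) n + cf_denom (\<lambda>k. b (Suc k)) n"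
  by (induction n rule: induct_nat_012) (auto simp: algebra_simps)

lemma cf_finite_eq_fraction:
  assumes "\<And>n. n \<ge> 1 \<Longrightarrow> b n \<ge> 1"
  shows "cf_finite b n = of_int (cf_num b n) / of_int (cf_denom b n)"
  using assms
proof (induction n arbitrary: b)
  case (Suc n)
  have "cf_num (\<lambda>k. b (Suc k)) n > 0"
    using cf_denom_pos[of b "Suc n", OF Suc.prems] by (simp add: cf_denom_Suc_eq_cf_num)
  moreover have "cf_finite (\<lambda>k. b (Suc k)) n =
      of_int (cf_num (\<lambda>k. b (Suc k)) n) / of_int (cf_denom (\<lambda>k. b (Suc k)) n)"
    using Suc.prems by (intro Suc.IH) auto
  ultimately show ?case
    by (simp add: cf_num_Suc cf_denom_Suc_eq_cf_num field_simps del: cf_num.simps)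
qed simp

lemma cf_num_denom_det: "cf_num b (Suc n) * cf_denom b n - cf_num b n * cf_denom b (Suc n) = (-1) ^ n"
  by (induction n) (auto simp: algebra_simps)

text \<open>As a function of \<open>k\<close>, the cross determinant satisfies the same recurrence with
  nonnegative coefficients as the denominators, so the bound propagates from the first two values.\<close>

lemma cf_cross_det_bounds:
  fixes b :: "nat \<Rightarrow> int" and m k :: nat
  defines "U \<equiv> \<lambda>k. (-1) ^ m * (cf_num b (m + k) * cf_denom b m - cf_num b m * cf_denom b (m + k))"
  assumes "\<And>n. n \<ge> 1 \<Longrightarrow> b n \<ge> 1"
  shows "0 \<le> U k \<and> U k * cf_denom b (Suc m) \<le> cf_denom b (m + k)"
proof (induction k rule: induct_nat_012)
  case 0
  then show ?case using cf_denom_pos[of b m, OF assms(2)] by (simp add: U_def)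
next
  case 1
  \<comment> \<open>The sign \<open>(-1) ^ m\<close> in \<open>U\<close> cancels the sign of the
    determinant of neighbours.\<close>
  have "U (Suc 0) = 1"
    using cf_num_denom_det[of b m] by (simp add: U_def flip: power_mult_distrib)
  then show ?case by simp
next
  case (ge2 k)
  define c where "c = b (Suc (Suc (m + k)))"
  have c: "c \<ge> 0" using assms(2)[of "Suc (Suc (m + k))"] by (simp add: c_def)
  have rec: "U (Suc (Suc k)) = c * U (Suc k) + U k"
    by (simp add: U_def c_def algebra_simps)
  have "c * (U (Suc k) * cf_denom b (Suc m)) \<le> c * cf_denom b (m + Suc k)"
    using ge2 c by (intro mult_left_mono) auto
  moreover have "c * U (Suc k) \<ge> 0" using c ge2 by simp
  ultimately show ?case
    using ge2 unfolding rec by (simp add: c_def algebra_simps)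
qed

section \<open>Approximation by convergents\<close>

lemma dist_int_le: "dist_int x \<le> \<bar>x - of_int k\<bar>"
  unfolding dist_int_eq_round by (rule round_diff_minimal)

text \<open>With \<alpha> replaced by a later convergent, the left side is a cross determinant
  divided by \<open>cf_denom b n\<close>, which \<open>cf_cross_det_bounds\<close> controls
  uniformly in \<open>n\<close>; the bound survives the limit.\<close>

lemma convergent_approx:
  assumes "is_simple_cf \<alpha> b"
  shows "\<bar>of_int (cf_denom b m) * \<alpha> - of_int (cf_num b m)\<bar> \<le> 1 / of_int (cf_denom b (Suc m))"
proof -
  have pos: "\<And>n. n \<ge> 1 \<Longrightarrow> b n \<ge> 1" and lim: "cf_finite b \<longlonglongrightarrow> \<alpha>"
    using assms by (auto simp: is_simple_cf_def)
  have "(\<lambda>n. \<bar>of_int (cf_denom b m) * cf_finite b n - of_int (cf_num b m)\<bar>)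
      \<longlonglongrightarrow> \<bar>of_int (cf_denom b m) * \<alpha> - of_int (cf_num b m)\<bar>"
    by (intro tendsto_intros lim)
  moreover have "\<bar>of_int (cf_denom b m) * cf_finite b n - of_int (cf_num b m)\<bar>
      \<le> 1 / of_int (cf_denom b (Suc m))" if "m \<le> n" for n
  proof -
    define W where "W = cf_num b n * cf_denom b m - cf_num b m * cf_denom b n"
    have Dn: "cf_denom b n > 0" and Dm: "cf_denom b (Suc m) > 0"
      using cf_denom_pos[of b, OF pos] by (metis zero_less_one less_le_trans)+
    have W: "0 \<le> (-1) ^ m * W" "(-1) ^ m * W * cf_denom b (Suc m) \<le> cf_denom b n"
      using cf_cross_det_bounds[of b m "n - m", OF pos] that by (auto simp: W_def)
    have "\<bar>W\<bar> = (-1) ^ m * W"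
      using W(1) by (cases "even m") auto
    then have "\<bar>W\<bar> * cf_denom b (Suc m) \<le> cf_denom b n"
      using W(2) by simp
    then have "real_of_int (\<bar>W\<bar> * cf_denom b (Suc m)) \<le> real_of_int (cf_denom b n)"
      by (rule of_int_le_iff[THEN iffD2])
    then have le: "\<bar>real_of_int W\<bar> * real_of_int (cf_denom b (Suc m)) \<le> real_of_int (cf_denom b n)"
      by simp
    have "of_int (cf_denom b m) * cf_finite b n - of_int (cf_num b m)
        = real_of_int W / real_of_int (cf_denom b n)"
      using Dn by (simp add: cf_finite_eq_fraction[of b, OF pos] W_def field_simps)
    then show ?thesis
      using le Dn Dm by (simp only: abs_divide) (simp add: field_simps)
  qed
  ultimately show ?thesis
    by (intro tendsto_upperbound[of _ _ sequentially]) (auto simp: eventually_sequentially)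
qed

lemma dist_int_combination_le:
  fixes x y :: int
  assumes "is_simple_cf \<alpha> b" and "\<bar>real_of_int x\<bar> \<le> T" and "\<bar>real_of_int y\<bar> \<le> T"
  shows "dist_int (of_int (x * cf_denom b m + y * cf_denom b (Suc m)) * \<alpha>)
    \<le> 2 * T / of_int (cf_denom b (Suc m))"
proof -
  have pos: "\<And>n. n \<ge> 1 \<Longrightarrow> b n \<ge> 1"
    using assms(1) by (auto simp: is_simple_cf_def)
  define \<delta> where "\<delta> = (\<lambda>m. of_int (cf_denom b m) * \<alpha> - of_int (cf_num b m))"
  define \<epsilon> where "\<epsilon> = 1 / real_of_int (cf_denom b (Suc m))"
  have \<delta>1: "\<bar>\<delta> m\<bar> \<le> \<epsilon>"
    using convergent_approx[OF assms(1), of m] by (simp add: \<delta>_def \<epsilon>_def)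
  have "\<bar>\<delta> (Suc m)\<bar> \<le> 1 / of_int (cf_denom b (Suc (Suc m)))"
    using convergent_approx[OF assms(1), of "Suc m"] by (simp only: \<delta>_def)
  also have "\<dots> \<le> \<epsilon>"
    unfolding \<epsilon>_def using cf_denom_less_Suc_Suc[of b m, OF pos] cf_denom_pos[of b "Suc m", OF pos]
    by (intro divide_left_mono mult_pos_pos) (auto simp del: cf_denom.simps)
  finally have \<delta>2: "\<bar>\<delta> (Suc m)\<bar> \<le> \<epsilon>" .
  \<comment> \<open>The nearby integer is the same combination of the numerators.\<close>
  have "dist_int (of_int (x * cf_denom b m + y * cf_denom b (Suc m)) * \<alpha>)
      \<le> \<bar>of_int (x * cf_denom b m + y * cf_denom b (Suc m)) * \<alpha>
          - of_int (x * cf_num b m + y * cf_num b (Suc m))\<bar>"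
    by (rule dist_int_le)
  also have "\<dots> = \<bar>of_int x * \<delta> m + of_int y * \<delta> (Suc m)\<bar>"
    unfolding \<delta>_def by (simp add: algebra_simps del: cf_num.simps cf_denom.simps)
  also have "\<dots> \<le> \<bar>of_int x\<bar> * \<bar>\<delta> m\<bar> + \<bar>of_int y\<bar> * \<bar>\<delta> (Suc m)\<bar>"
    by (metis abs_mult abs_triangle_ineq)
  also have "\<dots> \<le> T * \<epsilon> + T * \<epsilon>"
    using assms(2,3) \<delta>1 \<delta>2 by (intro add_mono mult_mono) auto
  finally show ?thesis by (simp add: \<epsilon>_def)
qed

section \<open>The index \<open>a(n)\<close>\<close>

lemma ex1_denom_index:
  assumes b: "\<And>n. n \<ge> 1 \<Longrightarrow> b n \<ge> 1" and d: "\<And>n. n \<ge> 1 \<Longrightarrow> d n \<ge> 1"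
  shows "\<exists>!m. is_denom_index b d n m"
proof -
  let ?P = "\<lambda>m. cf_denom d (n + 1) < cf_denom b m"
  define k where "k = (LEAST m. ?P m)"
  have "?P (nat (cf_denom d (n + 1)) + 1)"
    using cf_denom_ge_index[of b "nat (cf_denom d (n + 1)) + 1", OF b] by linarith
  then have k: "?P k" and least: "\<And>m. m < k \<Longrightarrow> \<not> ?P m"
    unfolding k_def by (rule LeastI, use not_less_Least in blast)
  \<comment> \<open>The denominator at index 0 is 1, which exceeds no denominator of
    \<open>d\<close>; so \<open>k\<close> has a predecessor, the required index.\<close>
  have "k \<noteq> 0"
    using k cf_denom_pos[of d "n + 1", OF d] by (intro notI) simp
  then obtain m where m: "k = Suc m" by (cases k) auto
  show ?thesis
  proof
    show "is_denom_index b d n m"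
      using k least[of m] m by (simp add: is_denom_index_def)
  next
    fix m' assume m': "is_denom_index b d n m'"
    have "k \<le> Suc m'"
      using m' least[of "Suc m'"] by (auto simp: is_denom_index_def not_le[symmetric])
    moreover have "m' < k"
      using m' k monoD[OF mono_cf_denom[of b, OF b], of k m'] by (force simp: is_denom_index_def)
    ultimately show "m' = m" using m by simp
  qed
qed

section \<open>A small common value of two linear forms\<close>

text \<open>Pigeonhole: the box holds \<open>(X + 1) ^ 4\<close> points, while the form, with two
  positive and two negative terms of size at most \<open>X * A\<close>, takes at most
  \<open>4 * X * A + 1\<close> values.\<close>

lemma siegel_four_unknowns:
  fixes p r s t A X :: int
  assumes "0 \<le> p" "p \<le> A" "0 \<le> r" "r \<le> A" "0 \<le> s" "s \<le> A" "0 \<le> t" "t \<le> A"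
    and X: "0 \<le> X" and A: "1 \<le> A" and cube: "4 * A < (X + 1) ^ 3"
  shows "\<exists>x y z v. x * p + y * r = z * s + v * t \<and> (x, y, z, v) \<noteq> (0, 0, 0, 0)
    \<and> \<bar>x\<bar> \<le> X \<and> \<bar>y\<bar> \<le> X \<and> \<bar>z\<bar> \<le> X \<and> \<bar>v\<bar> \<le> X"
proof -
  define f where "f = (\<lambda>(x, y, z, v). x * p + y * r - z * s - v * t)"
  define Q where "Q = {0..X} \<times> {0..X} \<times> {0..X} \<times> {0..X}"
  have prods: "0 \<le> x * c \<and> x * c \<le> X * A" if "x \<in> {0..X}" "0 \<le> c" "c \<le> A" for x c
    using that by (auto intro: mult_mono)
  have sub: "f ` Q \<subseteq> {- (2 * (X * A))..2 * (X * A)}"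
  proof
    fix w assume "w \<in> f ` Q"
    then obtain x y z v where w: "w = x * p + y * r - z * s - v * t"
      and "x \<in> {0..X}" "y \<in> {0..X}" "z \<in> {0..X}" "v \<in> {0..X}"
      by (auto simp: f_def Q_def)
    then show "w \<in> {- (2 * (X * A))..2 * (X * A)}"
      using prods[of x p] prods[of y r] prods[of z s] prods[of v t] assms(1-8)
      unfolding atLeastAtMost_iff by linarith
  qed
  have "card (f ` Q) \<le> nat (4 * (X * A) + 1)"
    using card_mono[OF _ sub] X A by (simp add: mult.commute)
  also have "\<dots> < nat ((X + 1) ^ 4)"
  proof -
    \<comment> \<open>Absorbing the 1 into \<open>4 * A\<close> produces the factor
      \<open>X + 1\<close> that turns the cube into a fourth power.\<close>
    have "4 * (X * A) + 1 \<le> (4 * A) * (X + 1)" using A by (simp add: algebra_simps)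
    also have "\<dots> < (X + 1) ^ 3 * (X + 1)" using cube X by (intro mult_strict_right_mono) auto
    also have "\<dots> = (X + 1) ^ 4" by (simp add: eval_nat_numeral)
    finally show ?thesis using X A by simp
  qed
  also have "\<dots> = card Q"
    using X by (simp add: Q_def card_cartesian_product nat_mult_distrib nat_power_eq eval_nat_numeral)
  finally have "\<not> inj_on f Q" by (rule pigeonhole)
  then obtain x y z v x' y' z' v'
    where "(x, y, z, v) \<in> Q" "(x', y', z', v') \<in> Q" "(x, y, z, v) \<noteq> (x', y', z', v')"
      "f (x, y, z, v) = f (x', y', z', v')"
    unfolding inj_on_def by (metis prod_cases4)
  then have "(x - x') * p + (y - y') * r = (z - z') * s + (v - v') * t"
    "(x - x', y - y', z - z', v - v') \<noteq> (0, 0, 0, 0)"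
    "\<bar>x - x'\<bar> \<le> X \<and> \<bar>y - y'\<bar> \<le> X \<and> \<bar>z - z'\<bar> \<le> X \<and> \<bar>v - v'\<bar> \<le> X"
    by (auto simp: f_def Q_def algebra_simps)
  then show ?thesis by blast
qed

lemma coprime_combination_eq_0:
  fixes x y p r :: int
  assumes "x * p + y * r = 0" "coprime p r" "\<bar>x\<bar> < r"
  shows "x = 0" "y = 0"
proof -
  have "r dvd x * p" using assms(1) by (metis add_eq_0_iff dvd_minus_iff dvd_triv_right)
  then have "r dvd x" using assms(2) by (simp add: coprime_dvd_mult_left_iff coprime_commute)
  then show "x = 0" using assms(3) zdvd_imp_le[of r "\<bar>x\<bar>"] by fastforce
  then show "y = 0" using assms(1,3) by simp
qed

text \<open>The Bezout coefficient of \<open>s\<close> is reduced modulo \<open>t\<close>. Then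
  \<open>v * t = p - z * s\<close> lies between \<open>- s * t\<close> and \<open>t\<close>, which
  confines \<open>v\<close> to the range from \<open>- s\<close> to 1.\<close>

lemma bounded_representation:
  fixes p s t :: int
  assumes "coprime s t" "0 \<le> p" "p \<le> t" "0 \<le> s" "s \<le> t" "1 \<le> t"
  shows "\<exists>z v. p = z * s + v * t \<and> \<bar>z\<bar> \<le> t \<and> \<bar>v\<bar> \<le> t"
proof -
  obtain u w where uw: "u * s + w * t = 1"
    using bezout_int[of s t] assms(1) by (auto simp: coprime_iff_gcd_eq_1)
  define z where "z = (u * p) mod t"
  define v where "v = w * p + (u * p) div t * s"
  have z: "0 \<le> z" "z \<le> t" using assms(6) by (auto simp: z_def intro: less_imp_le)
  have "z * s + v * t = (z + u * p div t * t) * s + w * p * t"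
    by (simp add: v_def algebra_simps)
  also have "z + u * p div t * t = u * p"
    unfolding z_def by (rule mod_div_mult_eq)
  also have "u * p * s + w * p * t = p * (u * s + w * t)"
    by (simp add: algebra_simps)
  finally have eq: "p = z * s + v * t" using uw by simp
  have zs: "0 \<le> z * s" "z * s \<le> t * s" using z assms(4) by (auto intro: mult_right_mono)
  have "v * t \<le> 1 * t" using eq zs assms(3) by linarith
  then have "v \<le> 1" by (rule mult_right_le_imp_le) (use assms(6) in simp)
  have "(- s) * t \<le> v * t" using eq zs assms(2) by (simp add: mult.commute)
  then have "- s \<le> v" by (rule mult_right_le_imp_le) (use assms(6) in simp)
  have "\<bar>v\<bar> \<le> t" using \<open>v \<le> 1\<close> \<open>- s \<le> v\<close> assms(5,6) by linarith
  then show ?thesis using eq z by (intro exI[of _ z] exI[of _ v]) auto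
qed

lemma common_positive_value:
  fixes p r s t X :: int
  assumes "coprime p r" "coprime s t" "1 \<le> p" "p \<le> t" "t < r" "0 \<le> s" "s \<le> t"
    and "0 \<le> X" "4 * r < (X + 1) ^ 3"
  shows "\<exists>x y z v. x * p + y * r = z * s + v * t \<and> x * p + y * r \<ge> 1
    \<and> \<bar>x\<bar> \<le> X \<and> \<bar>y\<bar> \<le> X \<and> \<bar>z\<bar> \<le> X \<and> \<bar>v\<bar> \<le> X"
proof (cases "t \<le> X")
  case True
  obtain z v where "p = z * s + v * t" "\<bar>z\<bar> \<le> t" "\<bar>v\<bar> \<le> t"
    using bounded_representation[of s t p] assms by auto
  then show ?thesis
    using True assms by (intro exI[of _ 1] exI[of _ 0] exI[of _ z] exI[of _ v]) auto
next
  case False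
  obtain x y z v where eq: "x * p + y * r = z * s + v * t"
    and nz: "(x, y, z, v) \<noteq> (0, 0, 0, 0)"
    and bd: "\<bar>x\<bar> \<le> X" "\<bar>y\<bar> \<le> X" "\<bar>z\<bar> \<le> X" "\<bar>v\<bar> \<le> X"
    \<comment> \<open>The largest of the four numbers, \<open>r\<close>, also serves as the common
      bound \<open>A\<close>.\<close>
    using siegel_four_unknowns[of p r r s t X] assms by auto
  have "x * p + y * r \<noteq> 0"
  proof
    assume q: "x * p + y * r = 0"
    \<comment> \<open>Here \<open>X < t < r\<close>, so the coefficients are too small for a
      nontrivial vanishing combination on either side.\<close>
    have "x = 0" "y = 0"
      using coprime_combination_eq_0[OF q] assms bd False by auto
    moreover have "z = 0" "v = 0"
      using coprime_combination_eq_0[of z s v t] q eq assms bd False by auto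
    ultimately show False using nz by simp
  qed
  \<comment> \<open>A negative value is repaired by changing all four signs, which keeps the
    bounds.\<close>
  then consider "x * p + y * r \<ge> 1" | "(- x) * p + (- y) * r \<ge> 1" by fastforce
  then show ?thesis
  proof cases
    case 1
    then show ?thesis using eq bd by blast
  next
    case 2
    then show ?thesis
      using eq bd by (intro exI[of _ "- x"] exI[of _ "- y"] exI[of _ "- z"] exI[of _ "- v"]) auto
  qed
qed

section \<open>Real exponents and the final estimates\<close>

lemma H_pos: "H > 0"
  by (simp add: H_def)

text \<open>Explains the choice of \<open>H\<close>: its cube is the 4 in the hypothesis
  \<open>4 * A < (X + 1) ^ 3\<close> of the pigeonhole argument.\<close>

lemma H_mult_cbrt_cubed:
  assumes "A \<ge> 0"
  shows "(H * A powr (1/3)) ^ 3 = 4 * A"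
  using assms by (cases "A = 0") (simp_all add: H_def power_mult_distrib powr_powr flip: powr_realpow)

text \<open>Trades a bound in \<open>A\<close> for one in \<open>q\<close>: the hypothesis gives
  \<open>q powr (1/2) \<le> K powr (1/2) * A powr (2/3)\<close>, and after multiplication all powers
  of \<open>A\<close> cancel.\<close>

lemma powr_approx_bound:
  fixes K A q :: real
  assumes "K > 0" "A > 0" "q > 0" "q \<le> K * A powr (1/3) * A"
  shows "K * A powr (1/3) / A \<le> K powr (3/2) / q powr (1/2)"
proof -
  have "q powr (1/2) \<le> (K * A powr (1/3) * A) powr (1/2)"
    using assms by (intro powr_mono2) auto
  also have "K * A powr (1/3) * A = K * A powr (4/3)"
    using assms(2) powr_add[of A "1/3" 1] by simp
  also have "(K * A powr (4/3)) powr (1/2) = K powr (1/2) * A powr (2/3)"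
    using assms by (simp add: powr_mult powr_powr)
  finally have "K * A powr (1/3) / A * q powr (1/2)
      \<le> K * A powr (1/3) / A * (K powr (1/2) * A powr (2/3))"
    using assms by (intro mult_left_mono) auto
  also have "\<dots> = (K * K powr (1/2)) * (A powr (1/3) * A powr (2/3) / A)"
    by simp
  also have "A powr (1/3) * A powr (2/3) / A = 1"
    using assms(2) by (simp flip: powr_add)
  also have "K * K powr (1/2) = K powr (3/2)"
    using assms(1) powr_add[of K 1 "1/2"] by simp
  finally show ?thesis
    using assms(3) by (simp add: pos_le_divide_eq)
qed

theorem theorem23:
  fixes \<alpha> \<beta> :: real and b d :: "nat \<Rightarrow> int"
  assumes "\<alpha> \<notin> \<rat>" and "\<beta> \<notin> \<rat>"
    and "is_simple_cf \<alpha> b" and "is_simple_cf \<beta> d"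
  shows "\<forall>n\<ge>1. (\<exists>!m. is_denom_index b d n m) \<and>
    (let a = denom_index b d n;
         admissible = (\<lambda>(x::int) (y::int) (z::int) (v::int) (q::int).
           q = x * cf_denom b a + y * cf_denom b (a + 1) \<and>
           q = z * cf_denom d n + v * cf_denom d (n + 1) \<and>
           q \<ge> 1 \<and>
           real_of_int (Max {\<bar>x\<bar>, \<bar>y\<bar>, \<bar>z\<bar>, \<bar>v\<bar>})
             \<le> H * real_of_int (cf_denom b (a + 1)) powr (1/3))
     in (\<exists>x y z v q. admissible x y z v q) \<and>
        (\<forall>x y z v q. admissible x y z v q \<longrightarrow>
           dist_int (real_of_int q * \<alpha>)
             \<le> (2 * H) powr (3/2) / real_of_int q powr (1/2) \<and>
           dist_int (real_of_int q * \<beta>)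
             \<le> (2 * H) powr (3/2) * real_of_int (b (a + 1) + 1) / real_of_int q powr (1/2)))"
proof (intro allI impI)
  fix n :: nat
  have b: "\<And>n. n \<ge> 1 \<Longrightarrow> b n \<ge> 1" and d: "\<And>n. n \<ge> 1 \<Longrightarrow> d n \<ge> 1"
    using assms by (auto simp: is_simple_cf_def)
  define a where "a = denom_index b d n"
  define p r s t where "p = cf_denom b a" and "r = cf_denom b (a + 1)"
    and "s = cf_denom d n" and "t = cf_denom d (n + 1)"
  define T where "T = H * real_of_int r powr (1/3)"
  have ex1: "\<exists>!m. is_denom_index b d n m"
    by (rule ex1_denom_index[of b d, OF b d])
  have "is_denom_index b d n a"
    unfolding a_def denom_index_def by (rule theI'[OF ex1])
  then have pt: "p \<le> t" and tr: "t < r"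
    by (auto simp: is_denom_index_def p_def r_def t_def)
  have pos: "1 \<le> p" "1 \<le> r" "1 \<le> s" "1 \<le> t"
    using cf_denom_pos[of b, OF b] cf_denom_pos[of d, OF d] by (auto simp: p_def r_def s_def t_def)
  have st: "s \<le> t"
    using monoD[OF mono_cf_denom[of d, OF d], of n "n + 1"] by (simp add: s_def t_def)
  have cop: "coprime p r" "coprime s t"
    using coprime_cf_denom_Suc[of b a] coprime_cf_denom_Suc[of d n]
    by (simp_all add: p_def r_def s_def t_def)
  have T0: "T > 0" using H_pos pos by (simp add: T_def)
  have exist: "\<exists>x y z v q. q = x * p + y * r \<and> q = z * s + v * t \<and> q \<ge> 1 \<and>
      real_of_int (Max {\<bar>x\<bar>, \<bar>y\<bar>, \<bar>z\<bar>, \<bar>v\<bar>}) \<le> T"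
  proof -
    have "real_of_int (4 * r) = T ^ 3"
      using H_mult_cbrt_cubed[of "real_of_int r"] pos by (simp add: T_def)
    \<comment> \<open>The integer box side is the floor of \<open>T\<close>, and \<open>T\<close> is
      less than its floor plus 1.\<close>
    also have "\<dots> < (real_of_int (\<lfloor>T\<rfloor> + 1)) ^ 3"
      using T0 by (intro power_strict_mono) (linarith | simp)+
    finally have "4 * r < (\<lfloor>T\<rfloor> + 1) ^ 3"
      by (metis of_int_less_iff of_int_power)
    then obtain x y z v where *: "x * p + y * r = z * s + v * t" "x * p + y * r \<ge> 1"
      "\<bar>x\<bar> \<le> \<lfloor>T\<rfloor>" "\<bar>y\<bar> \<le> \<lfloor>T\<rfloor>" "\<bar>z\<bar> \<le> \<lfloor>T\<rfloor>" "\<bar>v\<bar> \<le> \<lfloor>T\<rfloor>"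
      using common_positive_value[of p r s t "\<lfloor>T\<rfloor>"] cop pos pt tr st T0 by auto
    then have "Max {\<bar>x\<bar>, \<bar>y\<bar>, \<bar>z\<bar>, \<bar>v\<bar>} \<le> \<lfloor>T\<rfloor>"
      by simp
    then have "real_of_int (Max {\<bar>x\<bar>, \<bar>y\<bar>, \<bar>z\<bar>, \<bar>v\<bar>}) \<le> T"
      by (simp only: le_floor_iff)
    then show ?thesis using *(1,2) by blast
  qed
  have approx: "dist_int (real_of_int q * \<alpha>) \<le> (2 * H) powr (3/2) / real_of_int q powr (1/2) \<and>
      dist_int (real_of_int q * \<beta>)
        \<le> (2 * H) powr (3/2) * real_of_int (b (a + 1) + 1) / real_of_int q powr (1/2)"
    if q1: "q = x * p + y * r" and q2: "q = z * s + v * t" and q: "q \<ge> 1"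
      and max: "real_of_int (Max {\<bar>x\<bar>, \<bar>y\<bar>, \<bar>z\<bar>, \<bar>v\<bar>}) \<le> T" for x y z v q :: int
  proof -
    have le_T: "\<bar>real_of_int w\<bar> \<le> T" if "w \<in> {x, y, z, v}" for w
    proof -
      have "\<bar>w\<bar> \<le> Max {\<bar>x\<bar>, \<bar>y\<bar>, \<bar>z\<bar>, \<bar>v\<bar>}" using that by (intro Max_ge) auto
      then have "real_of_int \<bar>w\<bar> \<le> real_of_int (Max {\<bar>x\<bar>, \<bar>y\<bar>, \<bar>z\<bar>, \<bar>v\<bar>})"
        by (rule of_int_le_iff[THEN iffD2])
      also note max
      finally show ?thesis by (simp only: of_int_abs)
    qed
    have "real_of_int q = real_of_int x * real_of_int p + real_of_int y * real_of_int r"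
      by (simp add: q1)
    \<comment> \<open>Both denominators are at most \<open>r\<close>, since
      \<open>p \<le> t < r\<close>.\<close>
    also have "\<dots> \<le> T * real_of_int r + T * real_of_int r"
      using le_T[of x] le_T[of y] pos pt tr by (intro add_mono mult_mono) auto
    finally have "real_of_int q \<le> 2 * H * real_of_int r powr (1/3) * real_of_int r"
      by (simp add: T_def algebra_simps)
    then have main: "2 * T / real_of_int r \<le> (2 * H) powr (3/2) / real_of_int q powr (1/2)"
      using powr_approx_bound[of "2 * H" "real_of_int r" "real_of_int q"] H_pos pos q
      by (simp add: T_def mult.assoc)
    have \<alpha>: "dist_int (real_of_int q * \<alpha>) \<le> 2 * T / real_of_int r"
      using dist_int_combination_le[OF assms(3), of x T y a] le_T
      by (simp add: q1 p_def r_def)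
    have \<beta>: "dist_int (real_of_int q * \<beta>) \<le> 2 * T / real_of_int t"
      using dist_int_combination_le[OF assms(4), of z T v n] le_T
      by (simp add: q2 s_def t_def)
    have b1: "b (a + 1) \<ge> 1" using b by simp
    \<comment> \<open>The bound for \<beta> has \<open>t\<close> in the denominator, whereas
      \<open>main\<close> has \<open>r\<close>; passing through \<open>p \<le> t\<close> costs the
      factor \<open>b (a + 1) + 1\<close>.\<close>
    have "r \<le> (b (a + 1) + 1) * p"
      using cf_denom_Suc_le[of b a, OF b] by (simp add: p_def r_def)
    also have "\<dots> \<le> (b (a + 1) + 1) * t"
      using pt b1 by (intro mult_left_mono) auto
    finally have "real_of_int r \<le> real_of_int (b (a + 1) + 1) * real_of_int t"
      by (metis of_int_le_iff of_int_mult)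
    then have "1 / real_of_int t \<le> real_of_int (b (a + 1) + 1) / real_of_int r"
      using pos by (simp add: field_simps)
    then have "2 * T * (1 / real_of_int t) \<le> 2 * T * (real_of_int (b (a + 1) + 1) / real_of_int r)"
      using T0 by (intro mult_left_mono) auto
    also have "\<dots> = real_of_int (b (a + 1) + 1) * (2 * T / real_of_int r)"
      by simp
    also have "\<dots> \<le> real_of_int (b (a + 1) + 1) * ((2 * H) powr (3/2) / real_of_int q powr (1/2))"
      using b1 main by (intro mult_left_mono) auto
    finally show ?thesis using \<alpha> \<beta> main by (simp add: mult.commute)
  qed
  show "(\<exists>!m. is_denom_index b d n m) \<and>
    (let a = denom_index b d n;
         admissible = (\<lambda>(x::int) (y::int) (z::int) (v::int) (q::int).
           q = x * cf_denom b a + y * cf_denom b (a + 1) \<and>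
           q = z * cf_denom d n + v * cf_denom d (n + 1) \<and>
           q \<ge> 1 \<and>
           real_of_int (Max {\<bar>x\<bar>, \<bar>y\<bar>, \<bar>z\<bar>, \<bar>v\<bar>})
             \<le> H * real_of_int (cf_denom b (a + 1)) powr (1/3))
     in (\<exists>x y z v q. admissible x y z v q) \<and>
        (\<forall>x y z v q. admissible x y z v q \<longrightarrow>
           dist_int (real_of_int q * \<alpha>)
             \<le> (2 * H) powr (3/2) / real_of_int q powr (1/2) \<and>
           dist_int (real_of_int q * \<beta>)
             \<le> (2 * H) powr (3/2) * real_of_int (b (a + 1) + 1) / real_of_int q powr (1/2)))"
    unfolding Let_def a_def[symmetric] p_def[symmetric] r_def[symmetric] s_def[symmetric]
      t_def[symmetric] T_def[symmetric]
    using ex1 exist approx by blast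
qed

end
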